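(* Let $p\in[1,+\infty]$, let the source norm be $|||\cdot|||=\|\cdot\|_p$ on $\mathbb{R}^d$, and let $B_p=\{x\in\mathbb{R}^d:\|x\|_p\le 1\}$. Let $\varphi:\{0,1,\ldots,d\}\to\mathbb{R}_+\cup\{+\infty\}$ satisfy $\varphi(l)>\varphi(0)=0$ for all $l\in\{1,\ldots,d\}$ and $\varphi(l)<+\infty$ for at least one $l\in\{1,\ldots,d\}$. Assume that either - $p\in\,]1,+\infty]$ and, with $q$ such that $1/p+1/q=1$, the function $\{1,\ldots,d\}\ni l\mapsto\varphi(l)^q/l$ is nondecreasing; or - $p=1$ (and $q=+\infty$) and the function $\varphi$ is nondecreasing. Then the tightest norm below $\varphi\circ\ell_0$ on the unit ball $B_p$ is $|||\cdot|||^{\mathcal{R}}_{\varphi}=\varphi(1)\|\cdot\|_1$. In particular, the $\ell_1$-norm is the tightest norm below $\ell_0$ on the unit ball $B_p$ of any $\ell_p$-norm, for $p\in[1,\infty]$.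
   Context: $d$ is a positive integer and $\mathbb{R}^d$ has the Euclidean scalar product $\langle\cdot,\cdot\rangle$. $\ell_0(x)$ is the number of nonzero components of $x\in\mathbb{R}^d$, and $\|\cdot\|_p$ is the usual $\ell_p$-norm. If $p=+\infty$ then $q=1$. "The tightest norm below a function $g$ on a set $W$" means the greatest element, for the pointwise order, of the set of norms $N$ on $\mathbb{R}^d$ such that $N(x)\le g(x)$ for all $x\in W$. For a source norm $|||\cdot|||$, the norm $|||\cdot|||^{\mathcal{R}}_{\varphi}$ is defined as follows. For $y\in\mathbb{R}^d$ and $K\subset\{1,\ldots,d\}$, $y_K$ is the vector which coincides with $y$ except that its components outside $K$ are zero; $\mathcal{R}_K=\{x\in\mathbb{R}^d: x_j=0\ \forall j\notin K\}$; and for $y\in\mathcal{R}_K$, $|||y|||_{K,\star}=\sup\{\langle x,y\rangle: x\in\mathcal{R}_K,\ |||x|||\le 1\}$. For $k\in\{1,\ldots,d\}$, the generalized dual coordinate-$k$ norm is $|||y|||^{\mathcal{R}}_{(k),\star}=\sup_{|K|\le k}|||y_K|||_{K,\star}$, with unit ball $B^{\mathcal{R}}_{(k),\star}$. Then $|||x|||^{\mathcal{R}}_{\varphi}=\sup\{\langle x,y\rangle: y\in\bigcap_{l\in\{1,\ldots,d\}}\varphi(l)B^{\mathcal{R}}_{(l),\star}\}$, with the convention $(+\infty)B^{\mathcal{R}}_{(l),\star}=\mathbb{R}^d$; it is the norm whose dual norm has unit ball $\bigcap_{l}\varphi(l)B^{\mathcal{R}}_{(l),\star}$. *)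

theory Defs
  imports "HOL-Analysis.Analysis"
begin

text \<open>The space of dimension \<open>d \<ge> 1\<close> is \<open>real ^ 'n\<close> with \<open>d = CARD('n)\<close>; subsets \<open>K\<close> of
  \<open>{1, \<dots>, d}\<close> are subsets of the index type \<open>'n\<close>.\<close>

definition is_norm :: "('a::real_vector \<Rightarrow> real) \<Rightarrow> bool" where
  "is_norm N \<longleftrightarrow>
     (\<forall>x. 0 \<le> N x) \<and>
     (\<forall>x. N x = 0 \<longleftrightarrow> x = 0) \<and>
     (\<forall>c x. N (c *\<^sub>R x) = \<bar>c\<bar> * N x) \<and>
     (\<forall>x y. N (x + y) \<le> N x + N y)"

definition norms_below :: "('a::real_vector \<Rightarrow> ennreal) \<Rightarrow> 'a set \<Rightarrow> ('a \<Rightarrow> real) set" where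
  "norms_below g W = {N. is_norm N \<and> (\<forall>x\<in>W. ennreal (N x) \<le> g x)}"

definition tightest_norm_below ::
  "('a::real_vector \<Rightarrow> ennreal) \<Rightarrow> 'a set \<Rightarrow> ('a \<Rightarrow> real) \<Rightarrow> bool" where
  "tightest_norm_below g W N \<longleftrightarrow>
     N \<in> norms_below g W \<and> (\<forall>M\<in>norms_below g W. \<forall>x. M x \<le> N x)"

definition l0 :: "real ^ 'n \<Rightarrow> nat" where
  "l0 x = card {i. x $ i \<noteq> 0}"

definition lp_norm :: "ennreal \<Rightarrow> real ^ 'n \<Rightarrow> real" where
  "lp_norm p x =
     (if p = top then infnorm x
      else (\<Sum>i\<in>UNIV. \<bar>x $ i\<bar> powr enn2real p) powr (1 / enn2real p))"

definition lp_ball :: "ennreal \<Rightarrow> (real ^ 'n) set" where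
  "lp_ball p = {x. lp_norm p x \<le> 1}"

text \<open>The power \<open>a\<^sup>q\<close> of \<open>a \<in> [0, +\<infinity>]\<close>, for a real exponent \<open>q > 0\<close>.\<close>

definition ennreal_powr :: "ennreal \<Rightarrow> real \<Rightarrow> ennreal" where
  "ennreal_powr a q = (if a = top then top else ennreal (enn2real a powr q))"

definition restrict_vec :: "'n set \<Rightarrow> real ^ 'n \<Rightarrow> real ^ 'n" where
  "restrict_vec K y = (\<chi> i. if i \<in> K then y $ i else 0)"

definition coord_space :: "'n set \<Rightarrow> (real ^ 'n) set" where
  "coord_space K = {x. \<forall>j. j \<notin> K \<longrightarrow> x $ j = 0}"

text \<open>In the next two definitions \<open>N\<close> is the source norm. All suprema are taken in \<open>real\<close>:
  the sets are nonempty (they contain \<open>0\<close>), and bounded when \<open>N\<close> is a norm.\<close>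

definition coord_dual_norm :: "(real ^ 'n \<Rightarrow> real) \<Rightarrow> 'n set \<Rightarrow> real ^ 'n \<Rightarrow> real" where
  "coord_dual_norm N K y = (SUP x\<in>{x \<in> coord_space K. N x \<le> 1}. x \<bullet> y)"

definition gen_dual_coord_norm :: "(real ^ 'n \<Rightarrow> real) \<Rightarrow> nat \<Rightarrow> real ^ 'n \<Rightarrow> real" where
  "gen_dual_coord_norm N k y = (SUP K\<in>{K. card K \<le> k}. coord_dual_norm N K (restrict_vec K y))"

definition gen_dual_coord_ball :: "(real ^ 'n \<Rightarrow> real) \<Rightarrow> nat \<Rightarrow> (real ^ 'n) set" where
  "gen_dual_coord_ball N k = {y. gen_dual_coord_norm N k y \<le> 1}"

definition ennreal_scale :: "ennreal \<Rightarrow> 'a::real_vector set \<Rightarrow> 'a set" where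
  "ennreal_scale a B = (if a = top then UNIV else (\<lambda>y. enn2real a *\<^sub>R y) ` B)"

text \<open>The supremum below is again over a nonempty set; it is bounded when \<open>N\<close> is a norm and
  \<open>\<phi> l < top\<close> for some \<open>l\<close> in \<open>{1..d}\<close>. Only the values of \<open>\<phi>\<close> on \<open>{1..d}\<close> are used.\<close>

definition phi_norm ::
  "(real ^ 'n \<Rightarrow> real) \<Rightarrow> (nat \<Rightarrow> ennreal) \<Rightarrow> real ^ 'n \<Rightarrow> real" where
  "phi_norm N \<phi> x =
     (SUP y\<in>(\<Inter>l\<in>{1..CARD('n)}. ennreal_scale (\<phi> l) (gen_dual_coord_ball N l)). x \<bullet> y)"

end

theory Submission
  imports Defs
begin

text \<open>Every norm is below its largest value on the unit vectors times the \<open>\<ell>\<^sub>1\<close>-norm, and the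
  unit vectors lie in \<open>B\<^sub>p\<close>; so \<open>\<phi>(1) \<parallel>\<cdot>\<parallel>\<^sub>1\<close> is the tightest norm as soon as it is itself below
  \<open>\<phi> \<circ> \<ell>\<^sub>0\<close> on \<open>B\<^sub>p\<close>. Hoelder's inequality \<open>\<parallel>x\<parallel>\<^sub>1\<^sup>q \<le> \<ell>\<^sub>0(x)\<close> on \<open>B\<^sub>p\<close> and the monotonicity
  hypothesis give the stronger bound \<open>\<phi>(1) \<parallel>x\<parallel>\<^sub>1 \<le> \<phi>(l)\<close> for \<open>x \<in> B\<^sub>p\<close>, \<open>\<ell>\<^sub>0(x) \<le> l\<close>. It also
  shows that the ball for \<open>l = 1\<close>, the cube of half-side \<open>\<phi>(1)\<close>, is contained in all the other
  scaled dual balls, so that the defining supremum of the \<open>\<phi>\<close>-norm runs over this cube.\<close>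

section \<open>Multiples of the l1-norm and the norms below them\<close>

lemma lp_norm_1: "lp_norm 1 x = (\<Sum>i\<in>UNIV. \<bar>x $ i\<bar>)"
  by (simp add: lp_norm_def sum_nonneg)

lemma l1_nonneg: "0 \<le> lp_norm 1 x"
  by (simp add: lp_norm_1 sum_nonneg)

lemma is_norm_scaled_l1:
  assumes "c > 0"
  shows "is_norm (\<lambda>x::real^'n. c * lp_norm 1 x)"
proof -
  have "c * (\<Sum>i\<in>UNIV. \<bar>(x + y) $ i\<bar>) \<le> c * (\<Sum>i\<in>UNIV. \<bar>x $ i\<bar>) + c * (\<Sum>i\<in>UNIV. \<bar>y $ i\<bar>)"
    for x y :: "real^'n"
    unfolding distrib_left[symmetric] sum.distrib[symmetric]
    using assms by (intro mult_left_mono sum_mono) auto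
  moreover have "(\<Sum>i\<in>UNIV. \<bar>x $ i\<bar>) = 0 \<longleftrightarrow> x = 0" for x :: "real^'n"
    by (subst sum_nonneg_eq_0_iff) (auto simp: vec_eq_iff)
  ultimately show ?thesis
    using assms
    by (auto simp: is_norm_def lp_norm_1 sum_nonneg abs_mult simp flip: sum_distrib_left)
qed

lemma is_norm_0:
  assumes "is_norm M"
  shows "M 0 = 0"
  using assms by (simp add: is_norm_def)

lemma is_norm_sum_le:
  assumes "is_norm M" "finite S"
  shows "M (\<Sum>i\<in>S. f i) \<le> (\<Sum>i\<in>S. M (f i))"
  using assms(2)
proof (induction S rule: finite_induct)
  case empty
  then show ?case using is_norm_0[OF assms(1)] by simp
next
  case (insert i S)
  have "M (f i + (\<Sum>i\<in>S. f i)) \<le> M (f i) + M (\<Sum>i\<in>S. f i)"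
    using assms(1) by (simp add: is_norm_def)
  with insert show ?case by simp
qed

text \<open>Triangle inequality and homogeneity, applied to the expansion of \<open>x\<close> in the
  standard basis.\<close>

lemma is_norm_le_l1:
  fixes x :: "real^'n"
  assumes M: "is_norm M" and ax: "\<And>i. M (axis i 1) \<le> c"
  shows "M x \<le> c * lp_norm 1 x"
proof -
  have "x = (\<Sum>i\<in>UNIV. (x $ i) *\<^sub>R axis i 1)"
    using basis_expansion[of x] by (simp add: scalar_mult_eq_scaleR)
  then have "M x \<le> (\<Sum>i\<in>UNIV. M ((x $ i) *\<^sub>R axis i 1))"
    using is_norm_sum_le[OF M, of UNIV "\<lambda>i. (x $ i) *\<^sub>R axis i 1"] by simp
  also have "\<dots> = (\<Sum>i\<in>UNIV. \<bar>x $ i\<bar> * M (axis i 1))"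
    using M by (simp add: is_norm_def)
  also have "\<dots> \<le> (\<Sum>i\<in>UNIV. \<bar>x $ i\<bar> * c)"
    using ax by (intro sum_mono mult_left_mono) auto
  finally show ?thesis
    by (simp add: lp_norm_1 sum_distrib_left mult.commute)
qed

text \<open>The last two hypotheses bound every competing norm by \<open>c\<close> at the unit
  vectors, and \<open>is_norm_le_l1\<close> extends this to the whole space. With \<open>g\<close>
  and \<open>W\<close> abstract, the criterion serves both for \<open>\<phi>\<close> composed with
  \<open>l0\<close> and for \<open>l0\<close> itself.\<close>

lemma tightest_norm_below_scaled_l1:
  fixes W :: "(real^'n) set"
  assumes "c > 0" and "\<And>x. x \<in> W \<Longrightarrow> ennreal (c * lp_norm 1 x) \<le> g x"
    and "\<And>i. axis i 1 \<in> W" and "\<And>i. g (axis i 1) \<le> ennreal c"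
  shows "tightest_norm_below g W (\<lambda>x. c * lp_norm 1 x)"
  unfolding tightest_norm_below_def
proof (intro conjI ballI allI)
  show "(\<lambda>x. c * lp_norm 1 x) \<in> norms_below g W"
    using assms is_norm_scaled_l1 by (auto simp: norms_below_def)
next
  fix M and x :: "real^'n"
  assume M: "M \<in> norms_below g W"
  show "M x \<le> c * lp_norm 1 x"
  proof (rule is_norm_le_l1)
    show "is_norm M" using M by (simp add: norms_below_def)
    fix i
    have "ennreal (M (axis i 1)) \<le> g (axis i 1)"
      using M assms(3) by (simp add: norms_below_def)
    also have "\<dots> \<le> ennreal c" by (rule assms(4))
    finally show "M (axis i 1) \<le> c"
      using \<open>c > 0\<close> by (simp add: ennreal_le_iff)
  qed
qed

section \<open>Unit vectors and components in the unit ball of the lp-norm\<close>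

lemma l0_axis: "l0 (axis i (1::real)) = 1"
proof -
  have "{j. axis i (1::real) $ j \<noteq> 0} = {i}" by (auto simp: axis_def)
  then show ?thesis by (simp add: l0_def)
qed

text \<open>Both signs are covered because the dual ball for \<open>l = 1\<close> is tested against
  signed unit vectors.\<close>

lemma lp_norm_axis_le_1:
  assumes "1 \<le> p" "\<bar>s\<bar> = 1"
  shows "lp_norm p (axis i s :: real^'n) \<le> 1"
proof (cases "p = top")
  case True
  have "s * s = 1" using assms(2) by (metis abs_mult_self_eq mult_1)
  then have "norm (axis i s :: real^'n) = 1"
    by (simp add: norm_eq_sqrt_inner inner_axis_axis)
  then have "infnorm (axis i s :: real^'n) \<le> 1"
    using infnorm_le_norm[of "axis i s :: real^'n"] by simp
  then show ?thesis using True by (simp add: lp_norm_def)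
next
  case False
  have "(\<Sum>j\<in>UNIV. \<bar>(axis i s :: real^'n) $ j\<bar> powr enn2real p) = (\<Sum>j\<in>UNIV. if j = i then 1 else 0)"
    using assms by (intro sum.cong) (auto simp: axis_def)
  then show ?thesis using False by (simp add: lp_norm_def)
qed

lemma enn2real_ge_1:
  assumes "1 \<le> p" "p \<noteq> top"
  shows "1 \<le> enn2real p"
  using assms by (cases p) auto

lemma sum_powr_le_1:
  assumes "1 \<le> p" "p \<noteq> top" "lp_norm p x \<le> 1"
  shows "(\<Sum>i\<in>UNIV. \<bar>x $ i\<bar> powr enn2real p) \<le> 1"
proof (rule ccontr)
  assume "\<not> ?thesis"
  then have "1 < (\<Sum>i\<in>UNIV. \<bar>x $ i\<bar> powr enn2real p) powr (1 / enn2real p)"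
    using enn2real_ge_1[OF assms(1,2)] by (intro gr_one_powr) auto
  then show False using assms by (simp add: lp_norm_def)
qed

lemma component_le_1:
  assumes "1 \<le> p" "lp_norm p x \<le> 1"
  shows "\<bar>x $ i\<bar> \<le> 1"
proof (cases "p = top")
  case True
  then show ?thesis
    using component_le_infnorm_cart[of x i] assms by (simp add: lp_norm_def)
next
  case False
  have "\<bar>x $ i\<bar> powr enn2real p \<le> (\<Sum>i\<in>UNIV. \<bar>x $ i\<bar> powr enn2real p)"
    by (rule member_le_sum) auto
  also have "\<dots> \<le> 1" using sum_powr_le_1 assms False by blast
  finally show ?thesis
    using enn2real_ge_1[OF assms(1) False] gr_one_powr[of "\<bar>x $ i\<bar>" "enn2real p"] by fastforce
qed

section \<open>Bounds on the l1-norm by the number of nonzero components\<close>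

lemma l1_eq_sum_support: "lp_norm 1 x = (\<Sum>i\<in>{i. x $ i \<noteq> 0}. \<bar>x $ i\<bar>)"
  unfolding lp_norm_1 by (rule sum.mono_neutral_right) auto

text \<open>Each nonzero component contributes at most 1. This is the Hoelder bound for
  \<open>q = 1\<close>, and for every \<open>p\<close> it yields the claim about \<open>l0\<close>
  itself.\<close>

lemma l1_le_l0:
  assumes "1 \<le> p" "lp_norm p x \<le> 1"
  shows "lp_norm 1 x \<le> real (l0 x)"
proof -
  have "lp_norm 1 x \<le> (\<Sum>i\<in>{i. x $ i \<noteq> 0}. 1)"
    unfolding l1_eq_sum_support using component_le_1[OF assms] by (intro sum_mono)
  then show ?thesis by (simp add: l0_def)
qed

text \<open>Jensen's inequality for the convex function \<open>t powr r\<close> with equal weights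
  \<open>1 / card S\<close>.\<close>

lemma power_mean_sum:
  fixes f :: "'i \<Rightarrow> real"
  assumes "finite S" "\<And>i. i \<in> S \<Longrightarrow> f i > 0" "r \<ge> 1"
  shows "(\<Sum>i\<in>S. f i) powr r \<le> real (card S) powr (r - 1) * (\<Sum>i\<in>S. f i powr r)"
proof (cases "S = {}")
  case False
  define n where "n = real (card S)"
  have n: "n > 0" using False assms(1) by (simp add: n_def card_gt_0_iff)
  have "(\<Sum>i\<in>S. (1 / n) *\<^sub>R f i) powr r \<le> (\<Sum>i\<in>S. (1 / n) * f i powr r)"
    using n assms False
    by (intro convex_on_sum[OF assms(1) False powr_convex[OF assms(3)]]) (auto simp: n_def)
  then have "((\<Sum>i\<in>S. f i) / n) powr r \<le> (\<Sum>i\<in>S. f i powr r) / n"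
    by (simp add: sum_divide_distrib)
  moreover have "(\<Sum>i\<in>S. f i) \<ge> 0" using assms(2) by (intro sum_nonneg) (simp add: less_imp_le)
  ultimately have "(\<Sum>i\<in>S. f i) powr r / n powr r \<le> (\<Sum>i\<in>S. f i powr r) / n"
    using n by (simp add: powr_divide)
  then have "(\<Sum>i\<in>S. f i) powr r \<le> n powr r * ((\<Sum>i\<in>S. f i powr r) / n)"
    using n by (simp add: divide_le_eq mult.commute)
  also have "\<dots> = n powr (r - 1) * (\<Sum>i\<in>S. f i powr r)"
    using n by (simp add: powr_diff)
  finally show ?thesis by (simp add: n_def)
qed simp

text \<open>The power mean inequality is applied on the support, where the terms are positive. On
  the ball the sum of the powers is at most 1, and raising to \<open>q / r\<close> turns the
  exponent \<open>r - 1\<close> of \<open>l0 x\<close> into 1.\<close>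

lemma l1_powr_le_l0:
  assumes p: "1 \<le> p" "lp_norm p x \<le> 1" "p \<noteq> top" and q: "1 / enn2real p + 1 / q = 1" "q > 0"
  shows "lp_norm 1 x powr q \<le> real (l0 x)"
proof (cases "l0 x = 0")
  case True
  then have "lp_norm 1 x = 0" using l1_le_l0[OF p(1,2)] l1_nonneg[of x] by linarith
  then show ?thesis by simp
next
  case False
  define r where "r = enn2real p"
  have r: "r \<ge> 1" using enn2real_ge_1 p by (simp add: r_def)
  \<comment> \<open>Conjugacy of \<open>r\<close> and \<open>q\<close> amounts to
    \<open>q + r = q * r\<close>.\<close>
  have conj: "(r - 1) * (q / r) = 1" using q r by (simp add: r_def field_simps)
  have "lp_norm 1 x powr r
      \<le> real (l0 x) powr (r - 1) * (\<Sum>i\<in>{i. x $ i \<noteq> 0}. \<bar>x $ i\<bar> powr r)"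
    unfolding l1_eq_sum_support l0_def using r by (intro power_mean_sum) auto
  also have "(\<Sum>i\<in>{i. x $ i \<noteq> 0}. \<bar>x $ i\<bar> powr r) \<le> (\<Sum>i\<in>UNIV. \<bar>x $ i\<bar> powr r)"
    by (rule sum_mono2) auto
  also have "\<dots> \<le> 1" using sum_powr_le_1 p by (simp add: r_def)
  finally have "lp_norm 1 x powr r \<le> real (l0 x) powr (r - 1)"
    by (simp add: mult_left_mono)
  then have "(lp_norm 1 x powr r) powr (q / r) \<le> (real (l0 x) powr (r - 1)) powr (q / r)"
    using q r by (intro powr_mono2) auto
  then show ?thesis using r conj by (simp add: powr_powr)
qed

section \<open>Dual balls, the cube and its support function\<close>

lemma inner_le_l1:
  fixes x y :: "real^'n"
  assumes "\<And>i. \<bar>y $ i\<bar> \<le> b"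
  shows "x \<bullet> y \<le> b * lp_norm 1 x"
proof -
  have "x \<bullet> y = (\<Sum>i\<in>UNIV. x $ i * y $ i)" by (simp add: inner_vec_def)
  also have "\<dots> \<le> (\<Sum>i\<in>UNIV. b * \<bar>x $ i\<bar>)"
  proof (rule sum_mono)
    fix i
    have "x $ i * y $ i \<le> \<bar>x $ i\<bar> * \<bar>y $ i\<bar>" by (metis abs_ge_self abs_mult)
    also have "\<dots> \<le> \<bar>x $ i\<bar> * b" using assms by (intro mult_left_mono) auto
    finally show "x $ i * y $ i \<le> b * \<bar>x $ i\<bar>" by (simp add: mult.commute)
  qed
  finally show ?thesis by (simp add: lp_norm_1 sum_distrib_left)
qed

lemma l0_coord_space_le: "x \<in> coord_space K \<Longrightarrow> l0 (x::real^'n) \<le> card K"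
  unfolding l0_def coord_space_def by (intro card_mono) auto

text \<open>Vectors supported in \<open>K\<close> with \<open>card K \<le> l\<close> have at most
  \<open>l\<close> nonzero components, so \<open>inner_le_l1\<close> and the last hypothesis bound
  every inner product in the supremum by 1.\<close>

lemma mem_gen_dual_coord_ball:
  fixes y :: "real^'n"
  assumes "N 0 \<le> 1" and b: "\<And>i. \<bar>y $ i\<bar> \<le> b"
    and *: "\<And>x::real^'n. N x \<le> 1 \<Longrightarrow> l0 x \<le> l \<Longrightarrow> b * lp_norm 1 x \<le> 1"
  shows "y \<in> gen_dual_coord_ball N l"
proof -
  have "coord_dual_norm N K (restrict_vec K y) \<le> 1" if K: "card K \<le> l" for K
    unfolding coord_dual_norm_def
  proof (rule cSUP_least)
    show "{x \<in> coord_space K. N x \<le> 1} \<noteq> {}"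
      using assms(1) by (auto simp: coord_space_def intro!: exI[of _ 0])
    fix x assume x: "x \<in> {x \<in> coord_space K. N x \<le> 1}"
    have "\<bar>restrict_vec K y $ i\<bar> \<le> b" for i
      using b[of i] by (auto simp: restrict_vec_def)
    then have "x \<bullet> restrict_vec K y \<le> b * lp_norm 1 x" by (rule inner_le_l1)
    also have "\<dots> \<le> 1"
      using x l0_coord_space_le[of x K] K by (intro *) auto
    finally show "x \<bullet> restrict_vec K y \<le> 1" .
  qed
  moreover have "{K::'n set. card K \<le> l} \<noteq> {}" by (auto intro!: exI[of _ "{}"])
  ultimately show ?thesis
    by (auto simp: gen_dual_coord_ball_def gen_dual_coord_norm_def intro!: cSUP_least)
qed

text \<open>The set \<open>{i}\<close> is admissible for \<open>k = 1\<close>, and the unit vector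
  at \<open>i\<close> with the sign of \<open>y $ i\<close> has inner product
  \<open>\<bar>y $ i\<bar>\<close> with \<open>y\<close>.\<close>

lemma gen_dual_coord_ball_1_component:
  fixes y :: "real^'n"
  assumes ax: "\<And>i s. \<bar>s\<bar> = 1 \<Longrightarrow> N (axis i s) \<le> 1"
    and comp: "\<And>x i. N x \<le> 1 \<Longrightarrow> \<bar>x $ i\<bar> \<le> 1"
    and y: "y \<in> gen_dual_coord_ball N 1"
  shows "\<bar>y $ i\<bar> \<le> 1"
proof -
  define s where "s = (if y $ i \<ge> 0 then 1 else -1 :: real)"
  define z where "z = restrict_vec {i} y"
  \<comment> \<open>A real supremum dominates its members only when the set is bounded above;
    \<open>comp\<close> provides this.\<close>
  have bdd: "bdd_above ((\<lambda>x. x \<bullet> z) ` {x \<in> coord_space {i}. N x \<le> 1})"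
  proof (rule bdd_aboveI2)
    fix x assume x: "x \<in> {x \<in> coord_space {i}. N x \<le> 1}"
    have "z \<bullet> x \<le> 1 * lp_norm 1 z"
      using comp x by (intro inner_le_l1) auto
    then show "x \<bullet> z \<le> lp_norm 1 z" by (simp add: inner_commute)
  qed
  have "\<bar>y $ i\<bar> = axis i s \<bullet> z"
    by (simp add: inner_axis' z_def restrict_vec_def s_def)
  also have "\<dots> \<le> coord_dual_norm N {i} z"
    unfolding coord_dual_norm_def
  proof (rule cSUP_upper[OF _ bdd])
    show "axis i s \<in> {x \<in> coord_space {i}. N x \<le> 1}"
      using ax[of s i] by (auto simp: coord_space_def s_def axis_def)
  qed
  also have "\<dots> \<le> gen_dual_coord_norm N 1 y"
    unfolding gen_dual_coord_norm_def z_def by (rule cSUP_upper) auto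
  finally show ?thesis using y by (simp add: gen_dual_coord_ball_def)
qed

text \<open>The factor \<open>l = 1\<close> alone confines the intersection to the cube; conversely
  \<open>key\<close> puts the cube inside every factor.\<close>

lemma Inter_scaled_balls_eq_box:
  fixes N :: "real^'n \<Rightarrow> real" and \<phi> :: "nat \<Rightarrow> ennreal"
  assumes N0: "N 0 \<le> 1"
    and ax: "\<And>i s. \<bar>s\<bar> = 1 \<Longrightarrow> N (axis i s) \<le> 1"
    and comp: "\<And>x i. N x \<le> 1 \<Longrightarrow> \<bar>x $ i\<bar> \<le> 1"
    and c: "\<phi> 1 = ennreal c" "c > 0"
    and pos: "\<And>l. l \<in> {1..CARD('n)} \<Longrightarrow> \<phi> l > 0"
    and key: "\<And>l x. l \<in> {1..CARD('n)} \<Longrightarrow> N x \<le> 1 \<Longrightarrow> l0 x \<le> l \<Longrightarrow>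
                ennreal (c * lp_norm 1 x) \<le> \<phi> l"
  shows "(\<Inter>l\<in>{1..CARD('n)}. ennreal_scale (\<phi> l) (gen_dual_coord_ball N l)) =
         {y. \<forall>i. \<bar>y $ i\<bar> \<le> c}" (is "?I = ?B")
proof (rule set_eqI, rule iffI)
  fix y assume "y \<in> ?I"
  moreover have "1 \<in> {1..CARD('n)}" by (simp add: Suc_le_eq)
  ultimately have "y \<in> ennreal_scale (\<phi> 1) (gen_dual_coord_ball N 1)" by blast
  then obtain z where z: "z \<in> gen_dual_coord_ball N 1" "y = c *\<^sub>R z"
    using c by (auto simp: ennreal_scale_def)
  have "\<bar>y $ i\<bar> \<le> c" for i
    using gen_dual_coord_ball_1_component[OF ax comp z(1), of i] c
    by (simp add: z(2) abs_mult)
  then show "y \<in> ?B" by simp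
next
  fix y assume y: "y \<in> ?B"
  show "y \<in> ?I"
  proof
    fix l assume l: "l \<in> {1..CARD('n)}"
    show "y \<in> ennreal_scale (\<phi> l) (gen_dual_coord_ball N l)"
    proof (cases "\<phi> l = top")
      case False
      then obtain r where r: "\<phi> l = ennreal r" "r \<ge> 0" by (cases "\<phi> l") auto
      with pos[OF l] have "r > 0" by simp
      \<comment> \<open>After division by \<open>r\<close> the cube has half-side
        \<open>c / r\<close>, and \<open>key\<close> becomes the last hypothesis of
        \<open>mem_gen_dual_coord_ball\<close>.\<close>
      have "y /\<^sub>R r \<in> gen_dual_coord_ball N l"
      proof (rule mem_gen_dual_coord_ball[where b = "c / r"])
        show "\<bar>(y /\<^sub>R r) $ i\<bar> \<le> c / r" for i
          using y \<open>r > 0\<close> by (simp add: abs_mult divide_simps)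
        show "c / r * lp_norm 1 x \<le> 1" if "N x \<le> 1" "l0 x \<le> l" for x
          using key[OF l that] r \<open>r > 0\<close> by (simp add: ennreal_le_iff)
      qed (rule N0)
      then have "r *\<^sub>R (y /\<^sub>R r) \<in> (\<lambda>y. r *\<^sub>R y) ` gen_dual_coord_ball N l" by blast
      then show ?thesis using r \<open>r > 0\<close> by (simp add: ennreal_scale_def)
    qed (simp add: ennreal_scale_def)
  qed
qed

text \<open>The maximum is attained at the vector of the signs of \<open>x\<close>, scaled by
  \<open>c\<close>.\<close>

lemma SUP_inner_box:
  fixes x :: "real^'n"
  assumes "c \<ge> 0"
  shows "(SUP y\<in>{y. \<forall>i. \<bar>y $ i\<bar> \<le> c}. x \<bullet> y) = c * lp_norm 1 x"
proof (rule cSup_eq_maximum)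
  let ?y = "\<chi> i. c * sgn (x $ i)"
  have "x \<bullet> ?y = c * lp_norm 1 x"
    by (auto simp: inner_vec_def lp_norm_1 sum_distrib_left abs_sgn intro!: sum.cong)
  moreover have "?y \<in> {y. \<forall>i. \<bar>y $ i\<bar> \<le> c}"
    using assms by (auto simp: abs_mult abs_sgn_eq)
  ultimately show "c * lp_norm 1 x \<in> (\<bullet>) x ` {y. \<forall>i. \<bar>y $ i\<bar> \<le> c}"
    by (intro image_eqI[where x = ?y]) simp_all
qed (auto intro: inner_le_l1)

section \<open>Conjugate exponents and the monotonicity hypothesis\<close>

lemma l0_le_CARD: "l0 (x::real^'n) \<le> CARD('n)"
  unfolding l0_def by (intro card_mono) auto

text \<open>Transfers conjugacy to the reals, where \<open>enn2real\<close> sends \<open>top\<close>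
  to 0. The value \<open>q = top\<close> would force \<open>1 / p = 1\<close> against
  \<open>1 < p\<close>, and \<open>q = 0\<close> would make the sum infinite.\<close>

lemma conjugate_exponent_real:
  assumes "1 < p" "1 / p + 1 / q = (1::ennreal)"
  shows "q \<noteq> top" "q \<noteq> 0" "p = top \<Longrightarrow> q = 1"
    "p \<noteq> top \<Longrightarrow> 1 / enn2real p + 1 / enn2real q = 1"
proof -
  show qt: "q \<noteq> top"
  proof
    assume "q = top"
    then have 1: "1 / p = 1" using assms by simp
    then have "p \<noteq> top" by auto
    then obtain a where a: "p = ennreal a" "a \<ge> 0" by (cases p) auto
    then have "a > 1" using assms(1) by (simp add: ennreal_less_iff flip: ennreal_1)
    then show False using 1 a by (simp add: divide_ennreal flip: ennreal_1)
  qed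
  show q0: "q \<noteq> 0" using assms by auto
  obtain b where b: "q = ennreal b" "b > 0" using qt q0 by (cases q) (auto simp: less_le)
  show "q = 1" if "p = top"
    using assms b that by (auto simp: divide_ennreal simp flip: ennreal_1)
  show "1 / enn2real p + 1 / enn2real q = 1" if pt: "p \<noteq> top"
  proof -
    obtain a where a: "p = ennreal a" "a \<ge> 0" using pt by (cases p) auto
    then have "a > 1" using assms(1) by (simp add: ennreal_less_iff flip: ennreal_1)
    then show ?thesis using assms a b
      by (simp add: divide_ennreal flip: ennreal_1 ennreal_plus)
  qed
qed

lemma l1_powr_conjugate_le_l0:
  assumes "1 < p" "1 / p + 1 / q = (1::ennreal)" "lp_norm p x \<le> 1"
  shows "lp_norm 1 x powr enn2real q \<le> real (l0 x)"
proof (cases "p = top")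
  case True
  then show ?thesis
    using conjugate_exponent_real(3)[OF assms(1,2)] l1_le_l0[of p x] assms
    by (simp add: lp_norm_1 sum_nonneg)
next
  case False
  have "enn2real q > 0"
    using conjugate_exponent_real(1,2)[OF assms(1,2)] by (simp add: enn2real_positive_iff less_top zero_less_iff_neq_zero)
  then show ?thesis
    using conjugate_exponent_real(4)[OF assms(1,2)] assms False by (intro l1_powr_le_l0) auto
qed

text \<open>Monotonicity between \<open>1\<close> and \<open>l\<close> gives
  \<open>c powr q * l \<le> \<phi> l powr q\<close>, and Hoelder's inequality bounds the q-th power
  of the l1-norm by \<open>l\<close>. Multiplying and taking q-th roots gives the claim; it is
  trivial if \<open>\<phi> l = top\<close>.\<close>

lemma scaled_l1_le_of_mono_powr:
  fixes \<phi> :: "nat \<Rightarrow> ennreal" and x :: "real^'n"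
  assumes pq: "1 < p" "1 / p + 1 / q = (1::ennreal)"
    and mono: "mono_on {1..CARD('n)} (\<lambda>l. ennreal_powr (\<phi> l) (enn2real q) / of_nat l)"
    and c: "\<phi> 1 = ennreal c" "c > 0"
    and l: "l \<in> {1..CARD('n)}" and x: "lp_norm p x \<le> 1" "l0 x \<le> l"
  shows "ennreal (c * lp_norm 1 x) \<le> \<phi> l"
proof (cases "\<phi> l")
  case (real r)
  define Q where "Q = enn2real q"
  have Q: "Q > 0"
    using conjugate_exponent_real(1,2)[OF pq]
    by (simp add: Q_def enn2real_positive_iff less_top zero_less_iff_neq_zero)
  have "ennreal_powr (\<phi> 1) Q / of_nat 1 \<le> ennreal_powr (\<phi> l) Q / of_nat l"
    using l by (intro mono_onD[OF mono, folded Q_def]) auto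
  moreover have "ennreal_powr (\<phi> 1) Q / of_nat 1 = ennreal (c powr Q)"
    using c by (simp add: ennreal_powr_def divide_ennreal_def)
  moreover have "ennreal_powr (\<phi> l) Q / of_nat l = ennreal (r powr Q / real l)"
    using real l by (simp add: ennreal_powr_def divide_ennreal ennreal_of_nat_eq_real_of_nat)
  ultimately have "c powr Q \<le> r powr Q / real l"
    by (simp add: ennreal_le_iff)
  then have "c powr Q * real l \<le> r powr Q"
    using l by (simp add: pos_le_divide_eq)
  moreover have "lp_norm 1 x powr Q \<le> real l"
    using l1_powr_conjugate_le_l0[OF pq x(1)] x(2) by (simp add: Q_def)
  then have "c powr Q * lp_norm 1 x powr Q \<le> c powr Q * real l"
    by (intro mult_left_mono) auto
  ultimately have "c powr Q * lp_norm 1 x powr Q \<le> r powr Q" by linarith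
  then have "(c * lp_norm 1 x) powr Q \<le> r powr Q"
    using c by (simp add: powr_mult l1_nonneg)
  \<comment> \<open>The root is taken by contradiction, from strict monotonicity of the
    power.\<close>
  then have "c * lp_norm 1 x \<le> r"
    using Q real powr_less_mono2[of Q r "c * lp_norm 1 x"] by linarith
  then show ?thesis using real by (simp add: ennreal_leI)
qed simp

section \<open>The tightest norm and the \<phi>-norm\<close>

text \<open>Common core of the two cases of the hypothesis on \<open>\<phi>\<close>, which enter
  only through \<open>key\<close>. The choice \<open>l = l0 x\<close> serves the first claim; the
  dual balls call for all larger \<open>l\<close> too.\<close>

lemma tightest_norm_below_phi:
  fixes \<phi> :: "nat \<Rightarrow> ennreal"
  assumes p: "1 \<le> p" and phi0: "\<phi> 0 = 0"
    and pos: "\<And>l. l \<in> {1..CARD('n)} \<Longrightarrow> \<phi> l > 0"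
    and c: "\<phi> 1 = ennreal c" "c > 0"
    and key: "\<And>l x::real^'n. l \<in> {1..CARD('n)} \<Longrightarrow> lp_norm p x \<le> 1 \<Longrightarrow> l0 x \<le> l \<Longrightarrow>
                ennreal (c * lp_norm 1 x) \<le> \<phi> l"
  shows "tightest_norm_below (\<lambda>x::real^'n. \<phi> (l0 x)) (lp_ball p) (\<lambda>x. c * lp_norm 1 x)"
    and "phi_norm (lp_norm p) \<phi> = (\<lambda>x::real^'n. c * lp_norm 1 x)"
proof -
  show "tightest_norm_below (\<lambda>x::real^'n. \<phi> (l0 x)) (lp_ball p) (\<lambda>x. c * lp_norm 1 x)"
  proof (rule tightest_norm_below_scaled_l1[OF c(2)])
    fix x :: "real^'n" assume x: "x \<in> lp_ball p"
    show "ennreal (c * lp_norm 1 x) \<le> \<phi> (l0 x)"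
    proof (cases "l0 x = 0")
      \<comment> \<open>Index 0 is outside the range of \<open>key\<close>, but here
        \<open>x\<close> has l1-norm 0, so the left side vanishes.\<close>
      case True
      then show ?thesis using l1_le_l0[of p x] p x phi0 c(2)
        by (simp add: lp_ball_def ennreal_eq_0_iff mult_nonneg_nonpos)
    next
      case False
      then show ?thesis using x l0_le_CARD[of x] by (intro key) (auto simp: lp_ball_def)
    qed
  qed (use lp_norm_axis_le_1[OF p, of 1] c in \<open>auto simp: lp_ball_def l0_axis\<close>)
  have "lp_norm p (0::real^'n) \<le> 1" by (simp add: lp_norm_def infnorm_0)
  then have "(\<Inter>l\<in>{1..CARD('n)}. ennreal_scale (\<phi> l) (gen_dual_coord_ball (lp_norm p) l)) =
      {y::real^'n. \<forall>i. \<bar>y $ i\<bar> \<le> c}"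
    using lp_norm_axis_le_1[OF p] component_le_1[OF p] c pos key
    by (intro Inter_scaled_balls_eq_box) blast+
  then show "phi_norm (lp_norm p) \<phi> = (\<lambda>x::real^'n. c * lp_norm 1 x)"
    by (simp add: phi_norm_def fun_eq_iff SUP_inner_box[OF less_imp_le[OF c(2)]])
qed

theorem proposition10:
  fixes p :: ennreal
  assumes "1 \<le> p"
  shows
    "(\<forall>(q::ennreal) (\<phi>::nat \<Rightarrow> ennreal).
        1 / p + 1 / q = 1 \<longrightarrow>
        \<phi> 0 = 0 \<longrightarrow>
        (\<forall>l\<in>{1..CARD('n)}. \<phi> l > \<phi> 0) \<longrightarrow>
        (\<exists>l\<in>{1..CARD('n)}. \<phi> l < top) \<longrightarrow>
        (1 < p \<and> mono_on {1..CARD('n)} (\<lambda>l. ennreal_powr (\<phi> l) (enn2real q) / of_nat l) \<or>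
         p = 1 \<and> mono_on {0..CARD('n)} \<phi>) \<longrightarrow>
        tightest_norm_below (\<lambda>x::real^'n. \<phi> (l0 x)) (lp_ball p) (phi_norm (lp_norm p) \<phi>) \<and>
        (\<forall>x::real^'n. ennreal (phi_norm (lp_norm p) \<phi> x) = \<phi> 1 * ennreal (lp_norm 1 x))) \<and>
     tightest_norm_below (\<lambda>x::real^'n. of_nat (l0 x)) (lp_ball p) (lp_norm 1)"
proof (intro conjI allI impI)
  fix q :: ennreal and \<phi> :: "nat \<Rightarrow> ennreal"
  assume pq: "1 / p + 1 / q = 1" and phi0: "\<phi> 0 = 0"
    and pos: "\<forall>l\<in>{1..CARD('n)}. \<phi> l > \<phi> 0"
    and fin: "\<exists>l\<in>{1..CARD('n)}. \<phi> l < top"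
    and mono: "1 < p \<and> mono_on {1..CARD('n)} (\<lambda>l. ennreal_powr (\<phi> l) (enn2real q) / of_nat l) \<or>
               p = 1 \<and> mono_on {0..CARD('n)} \<phi>"
  have one: "1 \<in> {1..CARD('n)}" by (simp add: Suc_le_eq)
  obtain m where m: "m \<in> {1..CARD('n)}" "\<phi> m < top" using fin by blast
  \<comment> \<open>Either form of monotonicity carries finiteness from \<open>m\<close> back to
    \<open>1\<close>.\<close>
  have "\<phi> 1 \<noteq> top"
    using mono
  proof
    assume "p = 1 \<and> mono_on {0..CARD('n)} \<phi>"
    then have "\<phi> 1 \<le> \<phi> m" using m one by (auto intro: mono_onD)
    then show ?thesis using m(2) by auto
  next
    assume "1 < p \<and> mono_on {1..CARD('n)} (\<lambda>l. ennreal_powr (\<phi> l) (enn2real q) / of_nat l)"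
    then have "mono_on {1..CARD('n)} (\<lambda>l. ennreal_powr (\<phi> l) (enn2real q) / of_nat l)" ..
    from mono_onD[OF this one m(1)]
    have "ennreal_powr (\<phi> 1) (enn2real q) / of_nat 1 \<le> ennreal_powr (\<phi> m) (enn2real q) / of_nat m"
      using m by simp
    moreover have "ennreal_powr (\<phi> m) (enn2real q) / of_nat m < top"
      using m by (auto simp: ennreal_powr_def ennreal_divide_eq_top_iff simp flip: less_top)
    ultimately have "ennreal_powr (\<phi> 1) (enn2real q) / of_nat 1 \<noteq> top" by auto
    then show ?thesis by (auto simp: ennreal_powr_def ennreal_divide_eq_top_iff)
  qed
  then obtain c where c: "\<phi> 1 = ennreal c" "c \<ge> 0" by (cases "\<phi> 1") auto
  with pos phi0 one have c0: "c > 0" by force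
  have key: "ennreal (c * lp_norm 1 x) \<le> \<phi> l"
    if l: "l \<in> {1..CARD('n)}" and x: "lp_norm p x \<le> 1" "l0 x \<le> l" for l and x :: "real^'n"
    using mono
  proof
    assume "1 < p \<and> mono_on {1..CARD('n)} (\<lambda>l. ennreal_powr (\<phi> l) (enn2real q) / of_nat l)"
    then show ?thesis using pq c(1) c0 l x by (intro scaled_l1_le_of_mono_powr[of p q \<phi>]) auto
  next
    \<comment> \<open>For \<open>p = 1\<close> the ball condition itself bounds the l1-norm by 1, so
      the bound by \<open>\<phi> 1\<close> is immediate.\<close>
    assume p1: "p = 1 \<and> mono_on {0..CARD('n)} \<phi>"
    then have "ennreal (c * lp_norm 1 x) \<le> \<phi> 1"
      using x c c0 by (simp add: ennreal_leI)
    also have "\<dots> \<le> \<phi> l" using p1 l by (auto intro: mono_onD)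
    finally show ?thesis .
  qed
  note main = tightest_norm_below_phi[OF assms phi0 _ c(1) c0 key]
  have phi: "phi_norm (lp_norm p) \<phi> = (\<lambda>x::real^'n. c * lp_norm 1 x)"
    using pos phi0 by (intro main(2)) auto
  show "tightest_norm_below (\<lambda>x::real^'n. \<phi> (l0 x)) (lp_ball p) (phi_norm (lp_norm p) \<phi>)"
    unfolding phi using pos phi0 by (intro main(1)) auto
  show "ennreal (phi_norm (lp_norm p) \<phi> x) = \<phi> 1 * ennreal (lp_norm 1 x)" for x :: "real^'n"
    using c by (simp add: phi lp_norm_1 sum_nonneg ennreal_mult)
next
  \<comment> \<open>The criterion applies directly with \<open>c = 1\<close>, uniformly in
    \<open>p\<close>.\<close>
  have "tightest_norm_below (\<lambda>x::real^'n. of_nat (l0 x)) (lp_ball p) (\<lambda>x. 1 * lp_norm 1 x)"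
    using l1_le_l0[OF assms] lp_norm_axis_le_1[OF assms, of 1]
    by (intro tightest_norm_below_scaled_l1)
      (auto simp: lp_ball_def l0_axis ennreal_of_nat_eq_real_of_nat intro: ennreal_leI)
  then show "tightest_norm_below (\<lambda>x::real^'n. of_nat (l0 x)) (lp_ball p) (lp_norm 1)" by simp
qed

end
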